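(* Let $n\ge 2$ and let $\mathbf A$ be a finite algebra of type $\tau$ with $|A|=n$. Then $\mathbf A$ is primal if and only if $\mathbf A$ is a Boolean-like algebra of dimension $n$ (with respect to some $\tau$-terms $q,\mathsf e_1,\dots,\mathsf e_n$).
   Context: An algebra $\mathbf A$ of type $\tau$ is an algebra of dimension $n$ with respect to $\tau$-terms $q$ (arity $n+1$) and constant terms $\mathsf e_1,\dots,\mathsf e_n$ if $q^{\mathbf A}(\mathsf e_i^{\mathbf A},b_1,\dots,b_n)=b_i$ for all $b_j\in A$, $1\le i\le n$. $\theta(a,b)$ is the smallest congruence containing $(a,b)$. An element $c$ is $n$-central if $a\mapsto(a/\theta(c,\mathsf e_1),\dots,a/\theta(c,\mathsf e_n))$ is an isomorphism from $\mathbf A$ onto $\prod_i\mathbf A/\theta(c,\mathsf e_i)$. A Boolean-like algebra of dimension $n$ is an algebra of dimension $n$ all of whose elements are $n$-central. A nontrivial algebra $\mathbf A$ is primal if it is finite and for every $k\ge 0$ and every function $f:A^k\to A$ there is a $\tau$-term $t(x_1,\dots,x_k)$ with $f(a_1,\dots,a_k)=t^{\mathbf A}(a_1,\dots,a_k)$ for all $a_i\in A$. *)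

theory Defs
  imports "HOL-Library.FuncSet" "HOL-Library.NList"
begin

text \<open>The operation symbols of a type form a set rather than a HOL type, so that the empty
  type of algebras is covered.\<close>

record 'f signature =
  symbols :: "'f set"
  arity :: "'f \<Rightarrow> nat"

record ('f, 'a) ualg =
  univ :: "'a set"
  interp :: "'f \<Rightarrow> 'a list \<Rightarrow> 'a"

definition is_algebra :: "'f signature \<Rightarrow> ('f, 'a) ualg \<Rightarrow> bool" where
  "is_algebra \<tau> A \<longleftrightarrow>
     univ A \<noteq> {} \<and> (\<forall>f\<in>symbols \<tau>. interp A f \<in> nlists (arity \<tau> f) (univ A) \<rightarrow> univ A)"

datatype 'f trm = Var nat | App 'f "'f trm list"

inductive_set terms_over :: "'f signature \<Rightarrow> nat set \<Rightarrow> 'f trm set"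
  for \<tau> :: "'f signature" and V :: "nat set" where
  Var: "x \<in> V \<Longrightarrow> Var x \<in> terms_over \<tau> V"
| App: "f \<in> symbols \<tau> \<Longrightarrow> length ts = arity \<tau> f \<Longrightarrow> (\<And>t. t \<in> set ts \<Longrightarrow> t \<in> terms_over \<tau> V)
    \<Longrightarrow> App f ts \<in> terms_over \<tau> V"

primrec eval :: "('f, 'a) ualg \<Rightarrow> (nat \<Rightarrow> 'a) \<Rightarrow> 'f trm \<Rightarrow> 'a" where
  "eval A v (Var x) = v x"
| "eval A v (App f ts) = interp A f (map (eval A v) ts)"

text \<open>The variables of a \<open>k\<close>-ary term are \<open>Var 0, \<dots>, Var (k - 1)\<close>; a constant term is a term
  without variables, i.e.\ a \<open>0\<close>-ary term.\<close>

definition terms_of_arity :: "'f signature \<Rightarrow> nat \<Rightarrow> 'f trm set" where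
  "terms_of_arity \<tau> k = terms_over \<tau> {..<k}"

definition term_op :: "('f, 'a) ualg \<Rightarrow> 'f trm \<Rightarrow> 'a list \<Rightarrow> 'a" where
  "term_op A t xs = eval A (\<lambda>i. xs ! i) t"

definition congruence :: "'f signature \<Rightarrow> ('f, 'a) ualg \<Rightarrow> 'a rel \<Rightarrow> bool" where
  "congruence \<tau> A \<theta> \<longleftrightarrow> equiv (univ A) \<theta> \<and>
     (\<forall>f\<in>symbols \<tau>. \<forall>xs\<in>nlists (arity \<tau> f) (univ A). \<forall>ys\<in>nlists (arity \<tau> f) (univ A).
        list_all2 (\<lambda>x y. (x, y) \<in> \<theta>) xs ys \<longrightarrow> (interp A f xs, interp A f ys) \<in> \<theta>)"

definition principal_congruence :: "'f signature \<Rightarrow> ('f, 'a) ualg \<Rightarrow> 'a \<Rightarrow> 'a \<Rightarrow> 'a rel" where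
  "principal_congruence \<tau> A a b = \<Inter> {\<theta>. congruence \<tau> A \<theta> \<and> (a, b) \<in> \<theta>}"

text \<open>For a congruence \<open>\<theta>\<close>, all classes in the union below coincide, so that an operation maps the
  classes of \<open>x\<^sub>1, \<dots>, x\<^sub>k\<close> to the class of \<open>f(x\<^sub>1, \<dots>, x\<^sub>k)\<close>.\<close>

definition quotient_algebra :: "('f, 'a) ualg \<Rightarrow> 'a rel \<Rightarrow> ('f, 'a set) ualg" where
  "quotient_algebra A \<theta> =
     \<lparr>univ = univ A // \<theta>,
      interp = (\<lambda>f Xs. \<Union>xs\<in>{xs. list_all2 (\<in>) xs Xs}. \<theta> `` {interp A f xs})\<rparr>"

definition product_algebra :: "'i set \<Rightarrow> ('i \<Rightarrow> ('f, 'a) ualg) \<Rightarrow> ('f, 'i \<Rightarrow> 'a) ualg" where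
  "product_algebra I B =
     \<lparr>univ = (\<Pi>\<^sub>E i\<in>I. univ (B i)),
      interp = (\<lambda>f gs. \<lambda>i\<in>I. interp (B i) f (map (\<lambda>g. g i) gs))\<rparr>"

definition isomorphism ::
    "'f signature \<Rightarrow> ('f, 'a) ualg \<Rightarrow> ('f, 'b) ualg \<Rightarrow> ('a \<Rightarrow> 'b) \<Rightarrow> bool" where
  "isomorphism \<tau> A B h \<longleftrightarrow> bij_betw h (univ A) (univ B) \<and>
     (\<forall>f\<in>symbols \<tau>. \<forall>xs\<in>nlists (arity \<tau> f) (univ A). h (interp A f xs) = interp B f (map h xs))"

text \<open>In the following, \<open>es\<close> is the list of the constant terms \<open>e\<^sub>1, \<dots>, e\<^sub>n\<close>, so that \<open>es ! i\<close>
  with \<open>i < n\<close> is \<open>e\<^sub>i\<^sub>+\<^sub>1\<close>.\<close>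

definition algebra_of_dimension ::
    "'f signature \<Rightarrow> ('f, 'a) ualg \<Rightarrow> nat \<Rightarrow> 'f trm \<Rightarrow> 'f trm list \<Rightarrow> bool" where
  "algebra_of_dimension \<tau> A n q es \<longleftrightarrow>
     is_algebra \<tau> A \<and> q \<in> terms_of_arity \<tau> (n + 1) \<and> es \<in> nlists n (terms_of_arity \<tau> 0) \<and>
     (\<forall>bs\<in>nlists n (univ A). \<forall>i<n. term_op A q (term_op A (es ! i) [] # bs) = bs ! i)"

definition central :: "'f signature \<Rightarrow> ('f, 'a) ualg \<Rightarrow> nat \<Rightarrow> 'f trm list \<Rightarrow> 'a \<Rightarrow> bool" where
  "central \<tau> A n es c \<longleftrightarrow>
     (let \<theta> = (\<lambda>i. principal_congruence \<tau> A c (term_op A (es ! i) [])) in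
      isomorphism \<tau> A (product_algebra {..<n} (\<lambda>i. quotient_algebra A (\<theta> i)))
        (\<lambda>a. \<lambda>i\<in>{..<n}. \<theta> i `` {a}))"

definition boolean_like_algebra ::
    "'f signature \<Rightarrow> ('f, 'a) ualg \<Rightarrow> nat \<Rightarrow> 'f trm \<Rightarrow> 'f trm list \<Rightarrow> bool" where
  "boolean_like_algebra \<tau> A n q es \<longleftrightarrow>
     algebra_of_dimension \<tau> A n q es \<and> (\<forall>c\<in>univ A. central \<tau> A n es c)"

definition primal :: "'f signature \<Rightarrow> ('f, 'a) ualg \<Rightarrow> bool" where
  "primal \<tau> A \<longleftrightarrow>
     is_algebra \<tau> A \<and> (\<exists>a\<in>univ A. \<exists>b\<in>univ A. a \<noteq> b) \<and> finite (univ A) \<and>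
     (\<forall>k. \<forall>f \<in> nlists k (univ A) \<rightarrow> univ A.
        \<exists>t\<in>terms_of_arity \<tau> k. \<forall>xs\<in>nlists k (univ A). f xs = term_op A t xs)"

end

theory Submission
  imports Defs
begin

text \<open>If \<open>\<bar>A\<bar> = n \<ge> 2\<close>, then the identities \<open>q(e\<^sub>i, b\<^sub>1, \<dots>, b\<^sub>n) = b\<^sub>i\<close> force the constants
  \<open>e\<^sub>1, \<dots>, e\<^sub>n\<close> to be distinct and hence to exhaust \<open>A\<close>, so that \<open>q\<close> is an \<open>n\<close>-ary case
  distinction on its first argument. Primality follows by induction on the arity, via
  \<open>f(\<^bold>x, y) = q(y, f(\<^bold>x, e\<^sub>1), \<dots>, f(\<^bold>x, e\<^sub>n))\<close>. Conversely, primality provides terms for the case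
  distinction and for the constants. The case distinction makes \<open>A\<close> simple, so that for \<open>c = e\<^sub>j\<close>
  the congruence \<open>\<theta>(c, e\<^sub>i)\<close> is the identity for \<open>i = j\<close> and the total relation otherwise, and the
  canonical map is essentially the identity of \<open>A\<close>.\<close>

text \<open>As conditional simp rules with the premise \<open>xs \<in> nlists n A\<close>, these facts make the simplifier
  loop when \<open>nlists\<close> is unfolded.\<close>

declare nlistsE_length [simp del] nlistsE_set [simp del]

section \<open>Substitution into terms and evaluation\<close>

primrec subst_trm :: "(nat \<Rightarrow> 'f trm) \<Rightarrow> 'f trm \<Rightarrow> 'f trm" where
  "subst_trm \<sigma> (Var x) = \<sigma> x"
| "subst_trm \<sigma> (App f ts) = App f (map (subst_trm \<sigma>) ts)"

lemma eval_subst_trm: "eval A v (subst_trm \<sigma> t) = eval A (\<lambda>x. eval A v (\<sigma> x)) t"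
  by (induction t) (simp_all add: comp_def cong: map_cong)

lemma subst_trm_in_terms_over:
  assumes "t \<in> terms_over \<tau> V" and "\<And>x. x \<in> V \<Longrightarrow> \<sigma> x \<in> terms_over \<tau> W"
  shows "subst_trm \<sigma> t \<in> terms_over \<tau> W"
  using assms(1)
proof (induction rule: terms_over.induct)
  case (Var x)
  then show ?case using assms(2) by simp
next
  case (App f ts)
  then show ?case by (auto intro!: terms_over.App)
qed

lemma terms_over_mono:
  assumes "t \<in> terms_over \<tau> V" and "V \<subseteq> W"
  shows "t \<in> terms_over \<tau> W"
  using assms(1)
proof (induction rule: terms_over.induct)
  case (Var x)
  then show ?case using assms(2) by (blast intro: terms_over.Var)
next
  case (App f ts)
  then show ?case by (intro terms_over.App)
qed

text \<open>Makes the unspecified values \<open>xs ! i\<close> beyond the end of a list harmless,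
  and lets a \<open>k\<close>-ary term be evaluated at a longer list.\<close>

lemma eval_cong_on:
  assumes "t \<in> terms_over \<tau> V" and "\<And>x. x \<in> V \<Longrightarrow> v x = w x"
  shows "eval A v t = eval A w t"
  using assms(1)
proof (induction rule: terms_over.induct)
  case (Var x)
  then show ?case using assms(2) by simp
next
  case (App f ts)
  then have "map (eval A v) ts = map (eval A w) ts" by simp
  then show ?case by (simp only: eval.simps)
qed

lemma eval_in_univ:
  assumes "is_algebra \<tau> A" and "t \<in> terms_over \<tau> V" and "\<And>x. x \<in> V \<Longrightarrow> v x \<in> univ A"
  shows "eval A v t \<in> univ A"
  using assms(2)
proof (induction rule: terms_over.induct)
  case (Var x)
  then show ?case using assms(3) by simp
next
  case (App f ts)
  then have "map (eval A v) ts \<in> nlists (arity \<tau> f) (univ A)"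
    by (auto simp: nlists_def)
  with assms(1) App.hyps(1) show ?case
    by (auto simp: is_algebra_def Pi_iff)
qed

section \<open>Congruences and quotient maps\<close>

lemma congruence_eval:
  assumes "is_algebra \<tau> A" and \<theta>: "congruence \<tau> A \<theta>" and "t \<in> terms_over \<tau> V"
    and vw: "\<And>x. x \<in> V \<Longrightarrow> (v x, w x) \<in> \<theta>"
  shows "(eval A v t, eval A w t) \<in> \<theta>"
proof -
  \<comment> \<open>Compatibility is available only for argument lists over \<open>univ A\<close>,
    so the values of both assignments must be known to lie there.\<close>
  have sub: "\<theta> \<subseteq> univ A \<times> univ A"
    using \<theta> by (auto simp: congruence_def equiv_def refl_on_def)
  have in_univ: "v x \<in> univ A" "w x \<in> univ A" if "x \<in> V" for x
    using sub vw[OF that] by auto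
  show ?thesis
    using assms(3)
  proof (induction rule: terms_over.induct)
    case (Var x)
    then show ?case using vw by simp
  next
    case (App f ts)
    have "eval A v t \<in> univ A" "eval A w t \<in> univ A" if "t \<in> set ts" for t
      using App.hyps(3)[OF that] in_univ by (auto intro: eval_in_univ[OF assms(1)])
    then have "map (eval A v) ts \<in> nlists (arity \<tau> f) (univ A)"
      "map (eval A w) ts \<in> nlists (arity \<tau> f) (univ A)"
      using App.hyps(2) by (auto simp: nlists_def)
    moreover have "list_all2 (\<lambda>x y. (x, y) \<in> \<theta>) (map (eval A v) ts) (map (eval A w) ts)"
      using App.IH by (auto simp: list_all2_conv_all_nth)
    ultimately show ?case
      using \<theta> App.hyps(1) by (simp add: congruence_def)
  qed
qed

lemma congruence_refl: "congruence \<tau> A \<theta> \<Longrightarrow> a \<in> univ A \<Longrightarrow> (a, a) \<in> \<theta>"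
  by (auto simp: congruence_def equiv_def refl_on_def)

lemma congruence_Id_on:
  assumes "is_algebra \<tau> A"
  shows "congruence \<tau> A (Id_on (univ A))"
proof -
  have "xs = ys" if "list_all2 (\<lambda>x y. (x, y) \<in> Id_on (univ A)) xs ys" for xs ys
    using that by (auto simp: list_all2_conv_all_nth intro!: nth_equalityI)
  moreover have "equiv (univ A) (Id_on (univ A))"
    by (auto simp: equiv_def refl_on_def sym_def trans_def)
  ultimately show ?thesis
    using assms unfolding congruence_def is_algebra_def by (blast dest: funcset_mem)
qed

lemma congruence_total:
  assumes "is_algebra \<tau> A"
  shows "congruence \<tau> A (univ A \<times> univ A)"
proof -
  have "equiv (univ A) (univ A \<times> univ A)"
    by (auto simp: equiv_def refl_on_def sym_def trans_def)
  with assms show ?thesis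
    unfolding congruence_def is_algebra_def by (blast dest: funcset_mem)
qed

text \<open>The identity relation is a congruence containing \<open>(a, a)\<close>, and by
  reflexivity it lies below every other one.\<close>

lemma principal_congruence_refl:
  assumes "is_algebra \<tau> A" and "a \<in> univ A"
  shows "principal_congruence \<tau> A a a = Id_on (univ A)"
proof
  show "principal_congruence \<tau> A a a \<subseteq> Id_on (univ A)"
    unfolding principal_congruence_def using congruence_Id_on[OF assms(1)] assms(2) by blast
  show "Id_on (univ A) \<subseteq> principal_congruence \<tau> A a a"
    unfolding principal_congruence_def by (auto intro: congruence_refl)
qed

text \<open>The quotient operation is a union over all choices of representatives. Compatibility
  makes every choice contribute the same class.\<close>

lemma quotient_map_hom:
  assumes \<theta>: "congruence \<tau> A \<theta>" and f: "f \<in> symbols \<tau>"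
    and xs: "xs \<in> nlists (arity \<tau> f) (univ A)"
  shows "interp (quotient_algebra A \<theta>) f (map (\<lambda>a. \<theta> `` {a}) xs) = \<theta> `` {interp A f xs}"
proof -
  have eq: "equiv (univ A) \<theta>" using \<theta> by (simp add: congruence_def)
  have "\<theta> `` {interp A f ys} = \<theta> `` {interp A f xs}"
    if "list_all2 (\<in>) ys (map (\<lambda>a. \<theta> `` {a}) xs)" for ys
  proof -
    have rel: "list_all2 (\<lambda>x y. (x, y) \<in> \<theta>) xs ys"
      using that by (auto simp: list_all2_conv_all_nth)
    moreover have "ys \<in> nlists (arity \<tau> f) (univ A)"
    proof -
      have "\<theta> \<subseteq> univ A \<times> univ A" using eq by (auto simp: equiv_def refl_on_def)
      moreover have "(xs ! i, ys ! i) \<in> \<theta>" if "i < length ys" for i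
        using rel that by (simp add: list_all2_conv_all_nth)
      ultimately have "ys ! i \<in> univ A" if "i < length ys" for i
        using that by blast
      then have "set ys \<subseteq> univ A" by (auto simp: in_set_conv_nth)
      with xs list_all2_lengthD[OF rel] show ?thesis by (simp add: nlists_def)
    qed
    ultimately have "(interp A f xs, interp A f ys) \<in> \<theta>"
      using \<theta> f xs by (simp add: congruence_def)
    then show ?thesis by (simp add: equiv_class_eq[OF eq])
  qed
  \<comment> \<open>\<open>xs\<close> itself is a choice of representatives, so the union is not
    empty.\<close>
  moreover have "list_all2 (\<in>) xs (map (\<lambda>a. \<theta> `` {a}) xs)"
    unfolding list_all2_conv_all_nth
  proof (intro conjI allI impI)
    fix i assume "i < length xs"
    moreover from this xs have "xs ! i \<in> univ A" by (auto simp: nlists_def)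
    ultimately show "xs ! i \<in> map (\<lambda>a. \<theta> `` {a}) xs ! i"
      using congruence_refl[OF \<theta>] by simp
  qed simp
  ultimately show ?thesis
    unfolding quotient_algebra_def ualg.simps by blast
qed

lemma congruence_term_op_Cons:
  assumes "is_algebra \<tau> A" and "congruence \<tau> A \<theta>" and "q \<in> terms_of_arity \<tau> (n + 1)"
    and "(a, b) \<in> \<theta>" and "bs \<in> nlists n (univ A)"
  shows "(term_op A q (a # bs), term_op A q (b # bs)) \<in> \<theta>"
  unfolding term_op_def
proof (rule congruence_eval[OF assms(1,2)])
  show "q \<in> terms_over \<tau> {..<n + 1}" using assms(3) by (simp add: terms_of_arity_def)
  show "((a # bs) ! i, (b # bs) ! i) \<in> \<theta>" if "i \<in> {..<n + 1}" for i
  proof (cases i)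
    case 0
    then show ?thesis using assms(4) by simp
  next
    case (Suc k)
    with that assms(5) have "bs ! k \<in> univ A" by (auto simp: nlists_def)
    with Suc show ?thesis using congruence_refl[OF assms(2)] by simp
  qed
qed

section \<open>The constants of an algebra of dimension \<open>n\<close>\<close>

lemma constant_in_univ:
  assumes dim: "algebra_of_dimension \<tau> A n q es" and "i < n"
  shows "term_op A (es ! i) [] \<in> univ A"
proof -
  have "es ! i \<in> terms_over \<tau> {}"
    using assms nth_mem[of i es]
    by (auto simp: algebra_of_dimension_def terms_of_arity_def nlists_def)
  then show ?thesis
    unfolding term_op_def using dim
    by (intro eval_in_univ) (auto simp: algebra_of_dimension_def)
qed

text \<open>Identifying two different constants identifies the two entries that \<open>q\<close>
  selects with them, and these entries can be any two elements.\<close>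

lemma principal_congruence_constants:
  assumes dim: "algebra_of_dimension \<tau> A n q es"
    and ij: "i < n" "j < n" "i \<noteq> j"
  shows "principal_congruence \<tau> A (term_op A (es ! j) []) (term_op A (es ! i) []) =
    univ A \<times> univ A" (is "principal_congruence \<tau> A ?c ?d = _")
proof
  have alg: "is_algebra \<tau> A" and q: "q \<in> terms_of_arity \<tau> (n + 1)"
    using dim by (auto simp: algebra_of_dimension_def)
  show "principal_congruence \<tau> A ?c ?d \<subseteq> univ A \<times> univ A"
    unfolding principal_congruence_def
    using congruence_total[OF alg] constant_in_univ[OF dim] ij by blast
  have "(x, y) \<in> \<theta>"
    if \<theta>: "congruence \<tau> A \<theta>" "(?c, ?d) \<in> \<theta>" and xy: "x \<in> univ A" "y \<in> univ A" for x y \<theta>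
  proof -
    \<comment> \<open>\<open>x\<close> stands at the position selected by \<open>?c\<close> and
      \<open>y\<close> at every other one, in particular at the one selected by
      \<open>?d\<close>.\<close>
    define bs where "bs = (replicate n y)[j := x]"
    have bs: "bs \<in> nlists n (univ A)" "bs ! j = x" "bs ! i = y"
      using ij xy by (auto simp: bs_def nlists_def dest!: set_update_subset_insert[THEN subsetD])
    have "(term_op A q (?c # bs), term_op A q (?d # bs)) \<in> \<theta>"
      using congruence_term_op_Cons[OF alg \<theta>(1) q \<theta>(2) bs(1)] .
    then show ?thesis
      using dim bs ij by (simp add: algebra_of_dimension_def)
  qed
  then show "univ A \<times> univ A \<subseteq> principal_congruence \<tau> A ?c ?d"
    unfolding principal_congruence_def by auto
qed

text \<open>Let \<open>bs\<close> enumerate the algebra without repetition. If two constants were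
  equal, \<open>q\<close> would select the same entry of \<open>bs\<close> at two positions. So
  there are \<open>n\<close> distinct constants among \<open>n\<close> elements.\<close>

lemma constants_exhaust:
  assumes dim: "algebra_of_dimension \<tau> A n q es"
    and "finite (univ A)" "card (univ A) = n"
  shows "bij_betw (\<lambda>i. term_op A (es ! i) []) {..<n} (univ A)"
proof -
  let ?e = "\<lambda>i. term_op A (es ! i) []"
  obtain bs where bs: "set bs = univ A" "distinct bs"
    using finite_distinct_list[OF assms(2)] by blast
  then have len: "length bs = n" using assms(3) distinct_card by metis
  have "inj_on ?e {..<n}"
  proof (rule inj_onI)
    fix i j assume ij: "i \<in> {..<n}" "j \<in> {..<n}" "?e i = ?e j"
    have "bs ! k = term_op A q (?e k # bs)" if "k < n" for k
      using dim that bs len by (simp add: algebra_of_dimension_def nlists_def)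
    with ij have "bs ! i = bs ! j" by simp
    with bs len ij show "i = j" by (simp add: nth_eq_iff_index_eq)
  qed
  moreover from this have "?e ` {..<n} = univ A"
    using constant_in_univ[OF dim] assms(2,3)
    by (intro card_subset_eq) (auto simp: card_image)
  ultimately show ?thesis by (simp add: bij_betw_def)
qed

section \<open>All operations as term operations\<close>

lemma dimension_card_imp_term_op:
  assumes dim: "algebra_of_dimension \<tau> A n q es"
    and "finite (univ A)" "card (univ A) = n"
    and "f \<in> nlists k (univ A) \<rightarrow> univ A"
  shows "\<exists>t\<in>terms_of_arity \<tau> k. \<forall>xs\<in>nlists k (univ A). f xs = term_op A t xs"
  using assms(4)
proof (induction k arbitrary: f)
  case 0
  have "f [] \<in> univ A" using 0 by (auto simp: nlists_def)
  then obtain i where "i < n" "f [] = term_op A (es ! i) []"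
    using constants_exhaust[OF assms(1-3)] by (auto simp: bij_betw_def)
  moreover have "es ! i \<in> terms_of_arity \<tau> 0"
    using dim \<open>i < n\<close> by (auto simp: algebra_of_dimension_def nlists_def)
  ultimately show ?case by (auto simp: nlists_def)
next
  case (Suc k)
  let ?e = "\<lambda>i. term_op A (es ! i) []"
  note e = constant_in_univ[OF dim]
  \<comment> \<open>The induction hypothesis is applied to \<open>f\<close> with its last argument
    fixed at each constant.\<close>
  have "\<exists>t\<in>terms_of_arity \<tau> k. \<forall>xs\<in>nlists k (univ A). f (xs @ [?e i]) = term_op A t xs"
    if "i < n" for i
    using e[OF that] Suc.prems by (intro Suc.IH) (auto simp: nlists_def Pi_iff)
  then obtain t where t: "\<And>i. i < n \<Longrightarrow> t i \<in> terms_over \<tau> {..<k}"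
    "\<And>i xs. i < n \<Longrightarrow> xs \<in> nlists k (univ A) \<Longrightarrow> f (xs @ [?e i]) = term_op A (t i) xs"
    unfolding terms_of_arity_def by metis
  \<comment> \<open>Variable 0 of \<open>q\<close> is the selector and receives
    \<open>Var k\<close>, the last argument of \<open>f\<close>. The branches \<open>t i\<close> go
    to the later variables, hence the shift by one.\<close>
  define \<sigma> where "\<sigma> m = (case m of 0 \<Rightarrow> Var k | Suc i \<Rightarrow> t i)" for m
  have q: "q \<in> terms_over \<tau> {..<n + 1}"
    using dim by (simp add: algebra_of_dimension_def terms_of_arity_def)
  have "subst_trm \<sigma> q \<in> terms_of_arity \<tau> (Suc k)"
    unfolding terms_of_arity_def
  proof (rule subst_trm_in_terms_over[OF q])
    show "\<sigma> m \<in> terms_over \<tau> {..<Suc k}" if "m \<in> {..<n + 1}" for m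
      using that terms_over_mono[OF t(1), of _ "{..<Suc k}"]
      by (auto simp: \<sigma>_def split: nat.split intro: terms_over.Var)
  qed
  moreover have "f ys = term_op A (subst_trm \<sigma> q) ys" if ys: "ys \<in> nlists (Suc k) (univ A)" for ys
  proof -
    obtain xs x where ys_eq: "ys = xs @ [x]" and xs: "xs \<in> nlists k (univ A)" and x: "x \<in> univ A"
      using ys by (cases ys rule: rev_cases) (auto simp: nlists_def)
    obtain i where i: "i < n" "x = ?e i"
      using x constants_exhaust[OF assms(1-3)] by (auto simp: bij_betw_def)
    let ?bs = "map (\<lambda>j. term_op A (t j) xs) [0..<n]"
    have len: "length xs = k" using xs by (simp add: nlists_def)
    have "eval A (\<lambda>i. ys ! i) (\<sigma> m) = (x # ?bs) ! m" if "m \<in> {..<n + 1}" for m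
    proof (cases m)
      case 0
      then show ?thesis by (simp add: \<sigma>_def ys_eq flip: len)
    next
      case (Suc j)
      with that have j: "j < n" by simp
      \<comment> \<open>\<open>t j\<close> uses only variables below \<open>k\<close>, so it does
        not see the appended entry \<open>x\<close>.\<close>
      have "eval A (\<lambda>i. ys ! i) (t j) = eval A (\<lambda>i. xs ! i) (t j)"
        by (rule eval_cong_on[OF t(1)[OF j]]) (use len in \<open>simp add: ys_eq nth_append\<close>)
      with j Suc show ?thesis by (simp add: \<sigma>_def term_op_def)
    qed
    then have "term_op A (subst_trm \<sigma> q) ys = term_op A q (x # ?bs)"
      unfolding term_op_def eval_subst_trm by (intro eval_cong_on[OF q])
    also have "\<dots> = ?bs ! i"
    proof -
      \<comment> \<open>The identities for \<open>q\<close> cover only lists over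
        \<open>univ A\<close>; the entries of \<open>?bs\<close> lie there because they are values
        of \<open>f\<close>.\<close>
      have "term_op A (t j) xs \<in> univ A" if "j < n" for j
      proof -
        have "f (xs @ [?e j]) \<in> univ A"
          using Suc.prems xs e[OF that] by (auto simp: nlists_def Pi_iff)
        then show ?thesis using t(2)[OF that xs] by simp
      qed
      then have "?bs \<in> nlists n (univ A)" by (auto simp: nlists_def)
      then show ?thesis
        using dim i unfolding algebra_of_dimension_def by blast
    qed
    finally show ?thesis using i t(2)[OF i(1) xs] by (simp add: ys_eq)
  qed
  ultimately show ?case by blast
qed

section \<open>Centrality of all elements\<close>

lemma dimension_card_imp_central:
  assumes dim: "algebra_of_dimension \<tau> A n q es"
    and "finite (univ A)" "card (univ A) = n" and c: "c \<in> univ A"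
  shows "central \<tau> A n es c"
proof -
  have alg: "is_algebra \<tau> A" using dim by (simp add: algebra_of_dimension_def)
  obtain j where j: "j < n" "c = term_op A (es ! j) []"
    using c constants_exhaust[OF assms(1-3)] by (auto simp: bij_betw_def)
  define \<theta> where "\<theta> i = principal_congruence \<tau> A c (term_op A (es ! i) [])" for i
  have \<theta>_j: "\<theta> j = Id_on (univ A)"
    using principal_congruence_refl[OF alg c] j(2) by (simp add: \<theta>_def)
  have \<theta>_i: "\<theta> i = univ A \<times> univ A" if "i < n" "i \<noteq> j" for i
    using principal_congruence_constants[OF dim that(1) j(1) that(2)] j(2) by (simp add: \<theta>_def)
  have cong: "congruence \<tau> A (\<theta> i)" if "i < n" for i
    using congruence_Id_on[OF alg] congruence_total[OF alg] \<theta>_j \<theta>_i[OF that] by metis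
  let ?h = "\<lambda>a. \<lambda>i\<in>{..<n}. \<theta> i `` {a}"
  let ?P = "product_algebra {..<n} (\<lambda>i. quotient_algebra A (\<theta> i))"
  have univ_P: "univ ?P = (\<Pi>\<^sub>E i\<in>{..<n}. univ A // \<theta> i)"
    by (simp add: product_algebra_def quotient_algebra_def)
  have "bij_betw ?h (univ A) (univ ?P)"
    unfolding bij_betw_def
  proof
    show "inj_on ?h (univ A)"
    proof (rule inj_onI)
      fix a b assume ab: "a \<in> univ A" "b \<in> univ A" "?h a = ?h b"
      from fun_cong[OF ab(3), of j] j(1) have "\<theta> j `` {a} = \<theta> j `` {b}" by simp
      with ab show "a = b" by (auto simp: \<theta>_j)
    qed
    show "?h ` univ A = univ ?P"
    proof
      show "?h ` univ A \<subseteq> univ ?P"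
        by (auto simp: univ_P quotientI)
      show "univ ?P \<subseteq> ?h ` univ A"
      proof
        fix g assume "g \<in> univ ?P"
        then have g: "g \<in> extensional {..<n}" "\<And>i. i < n \<Longrightarrow> g i \<in> univ A // \<theta> i"
          by (auto simp: univ_P PiE_def)
        obtain a where a: "a \<in> univ A" "g j = \<theta> j `` {a}"
          using g(2)[OF j(1)] by (auto elim: quotientE)
        \<comment> \<open>For \<open>i \<noteq> j\<close> the quotient has a single class, so
          coordinate \<open>j\<close> alone determines \<open>g\<close>.\<close>
        have "g i = \<theta> i `` {a}" if i: "i < n" for i
        proof (cases "i = j")
          case False
          then show ?thesis using g(2)[OF i] a(1) by (auto simp: \<theta>_i[OF i] elim!: quotientE)
        qed (simp add: a(2))
        with g(1) have "g = ?h a" by (intro extensionalityI[of g "{..<n}"]) auto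
        with a(1) show "g \<in> ?h ` univ A" by blast
      qed
    qed
  qed
  moreover have "?h (interp A f xs) = interp ?P f (map ?h xs)"
    if "f \<in> symbols \<tau>" "xs \<in> nlists (arity \<tau> f) (univ A)" for f xs
  proof
    \<comment> \<open>\<open>i\<close> is arbitrary: outside \<open>{..<n}\<close> both sides are
      \<open>undefined\<close>.\<close>
    fix i
    show "?h (interp A f xs) i = interp ?P f (map ?h xs) i"
      using quotient_map_hom[OF cong that, of i]
      by (auto simp: product_algebra_def comp_def)
  qed
  ultimately show ?thesis
    by (simp add: central_def isomorphism_def \<theta>_def)
qed

section \<open>Case distinction from primality\<close>

lemma primal_imp_dimension:
  assumes prim: "primal \<tau> A" and "card (univ A) = n"
  shows "\<exists>q es. algebra_of_dimension \<tau> A n q es"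
proof -
  have alg: "is_algebra \<tau> A" and fin: "finite (univ A)"
    using prim by (auto simp: primal_def)
  have terms: "\<exists>t\<in>terms_of_arity \<tau> k. \<forall>xs\<in>nlists k (univ A). f xs = term_op A t xs"
    if "f \<in> nlists k (univ A) \<rightarrow> univ A" for f k
    using prim that by (simp add: primal_def)
  obtain as where as: "set as = univ A" "distinct as"
    using finite_distinct_list[OF fin] by blast
  then have len: "length as = n" using assms(2) distinct_card by metis
  have "\<exists>t\<in>terms_of_arity \<tau> 0. term_op A t [] = as ! i" if "i < n" for i
  proof -
    have "(\<lambda>_. as ! i) \<in> nlists 0 (univ A) \<rightarrow> univ A"
      using that as len nth_mem by blast
    from terms[OF this] show ?thesis by auto
  qed
  then obtain e where e: "\<And>i. i < n \<Longrightarrow> e i \<in> terms_of_arity \<tau> 0"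
    "\<And>i. i < n \<Longrightarrow> term_op A (e i) [] = as ! i"
    by metis
  \<comment> \<open>\<open>idx\<close> recovers the position of an element in the enumeration
    \<open>as\<close>, whose entries are the values of the constants \<open>e i\<close>.\<close>
  define idx where "idx = the_inv_into {..<n} ((!) as)"
  have bij: "bij_betw ((!) as) {..<n} (univ A)"
    using as len by (auto intro: bij_betw_nth)
  have idx_nth: "idx (as ! i) = i" if "i < n" for i
    using bij that by (simp add: idx_def bij_betw_def the_inv_into_f_f)
  have idx_less: "idx a < n" if a: "a \<in> univ A" for a
  proof -
    obtain i where "i < n" "a = as ! i"
      using a bij by (auto simp: bij_betw_def)
    then show ?thesis by (simp add: idx_nth)
  qed
  \<comment> \<open>This case distinction becomes \<open>q\<close>: the first entry is decoded to an
    index into the remaining \<open>n\<close> entries.\<close>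
  have "(\<lambda>xs. tl xs ! idx (hd xs)) \<in> nlists (n + 1) (univ A) \<rightarrow> univ A"
  proof
    fix xs assume "xs \<in> nlists (n + 1) (univ A)"
    then obtain x ys where "xs = x # ys" "x \<in> univ A" "length ys = n" "set ys \<subseteq> univ A"
      by (cases xs) (auto simp: nlists_def)
    then show "tl xs ! idx (hd xs) \<in> univ A"
      using idx_less nth_mem[of "idx x" ys] by auto
  qed
  from terms[OF this] obtain q where q: "q \<in> terms_of_arity \<tau> (n + 1)"
    "\<And>xs. xs \<in> nlists (n + 1) (univ A) \<Longrightarrow> tl xs ! idx (hd xs) = term_op A q xs"
    by blast
  have "algebra_of_dimension \<tau> A n q (map e [0..<n])"
    unfolding algebra_of_dimension_def
  proof (intro conjI ballI allI impI)
    show "map e [0..<n] \<in> nlists n (terms_of_arity \<tau> 0)"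
      using e(1) by (auto simp: nlists_def)
    fix bs i assume "bs \<in> nlists n (univ A)" "i < n"
    then have "as ! i # bs \<in> nlists (n + 1) (univ A)"
      using as len by (auto simp: nlists_def)
    from q(2)[OF this] \<open>i < n\<close>
    show "term_op A q (term_op A (map e [0..<n] ! i) [] # bs) = bs ! i"
      by (simp add: e(2) idx_nth)
  qed (use alg q(1) in auto)
  then show ?thesis by blast
qed

theorem theorem4p12:
  fixes \<tau> :: "'f signature" and A :: "('f, 'a) ualg" and n :: nat
  assumes "n \<ge> 2" and "is_algebra \<tau> A" and "finite (univ A)" and "card (univ A) = n"
  shows "primal \<tau> A \<longleftrightarrow> (\<exists>q es. boolean_like_algebra \<tau> A n q es)"
proof
  assume "primal \<tau> A"
  then obtain q es where "algebra_of_dimension \<tau> A n q es"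
    using primal_imp_dimension assms(4) by blast
  then show "\<exists>q es. boolean_like_algebra \<tau> A n q es"
    using dimension_card_imp_central[OF _ assms(3,4)] unfolding boolean_like_algebra_def by blast
next
  assume "\<exists>q es. boolean_like_algebra \<tau> A n q es"
  then obtain q es where dim: "algebra_of_dimension \<tau> A n q es"
    by (auto simp: boolean_like_algebra_def)
  \<comment> \<open>Primality includes nontriviality, which comes from
    \<open>n \<ge> 2\<close>.\<close>
  have "\<exists>a\<in>univ A. \<exists>b\<in>univ A. a \<noteq> b"
    using assms(1,4) card_le_Suc0_iff_eq[OF assms(3)] by fastforce
  with assms dimension_card_imp_term_op[OF dim assms(3,4)] show "primal \<tau> A"
    by (simp add: primal_def)
qed

end
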